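(* For every $\gamma>0$, the class $\mathcal{S}(\gamma)$ is not closed under convolution roots; that is, there exist a distribution $\mu$ on $\mathbb{R}$ and $n\in\mathbb{N}$ such that $\mu^{n*}\in\mathcal{S}(\gamma)$ but $\mu\notin\mathcal{S}(\gamma)$.
   Context: For a probability distribution $\rho$ on $\mathbb{R}$: $\bar\rho(x):=\rho((x,\infty))$ is its tail, $\rho^{n*}$ its $n$-th convolution power, and for $\gamma\in\mathbb{R}$, $\widehat\rho(\gamma):=\int_{-\infty}^\infty e^{\gamma x}\rho(dx)$ (and, when this is finite, $\widehat\rho(\gamma+iz):=\int e^{(\gamma+iz)x}\rho(dx)$ for $z\in\mathbb{R}$). For positive functions, $f\sim g$ means $f(x)/g(x)\to1$ as $x\to\infty$. Let $\gamma\ge0$. $\rho\in\mathcal{L}(\gamma)$ if $\bar\rho(x)>0$ for all $x\in\mathbb{R}$ and $\bar\rho(x+a)\sim e^{-\gamma a}\bar\rho(x)$ for every $a\in\mathbb{R}$. $\rho\in\mathcal{S}(\gamma)$ if $\rho\in\mathcal{L}(\gamma)$, $\widehat\rho(\gamma)<\infty$, and $\overline{\rho^{2*}}(x)\sim2\widehat\rho(\gamma)\bar\rho(x)$. A class $\mathcal{C}$ of distributions on $\mathbb{R}$ is closed under convolution roots if $\mu^{n*}\in\mathcal{C}$ for some $n\in\mathbb{N}$ implies $\mu\in\mathcal{C}$. *)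

theory Defs
  imports "HOL-Probability.Probability" "HOL-Library.Landau_Symbols"
begin

definition real_distribution :: "real measure \<Rightarrow> bool" where
  "real_distribution M \<longleftrightarrow> prob_space M \<and> sets M = sets borel"

fun conv_pow :: "real measure \<Rightarrow> nat \<Rightarrow> real measure" where
  "conv_pow M 0 = return borel 0"
| "conv_pow M (Suc n) = convolution M (conv_pow M n)"

definition tail :: "real measure \<Rightarrow> real \<Rightarrow> real" where
  "tail M x = measure M {x<..}"

definition mgf :: "real measure \<Rightarrow> real \<Rightarrow> ennreal" where
  "mgf M g = (\<integral>\<^sup>+ x. ennreal (exp (g * x)) \<partial>M)"

definition class_L :: "real \<Rightarrow> real measure \<Rightarrow> bool" where
  "class_L g M \<longleftrightarrow> (\<forall>x. tail M x > 0) \<and>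
     (\<forall>a. (\<lambda>x. tail M (x + a)) \<sim>[at_top] (\<lambda>x. exp (- g * a) * tail M x))"

definition class_S :: "real \<Rightarrow> real measure \<Rightarrow> bool" where
  "class_S g M \<longleftrightarrow> class_L g M \<and> mgf M g < \<infinity> \<and>
     (\<lambda>x. tail (conv_pow M 2) x) \<sim>[at_top] (\<lambda>x. 2 * enn2real (mgf M g) * tail M x)"

end

theory Submission
  imports Defs "HOL-Real_Asymp.Real_Asymp"
begin

text \<open>
  Let \<open>p \<ge> 0\<close> be an integrable density with \<open>p x = (1 + sin x + o(1)) / x\<^sup>2\<close>.
  One big jump dominates in \<open>p * p\<close>, so \<open>(p * p) x\<close> is asymptotically
  \<open>2 / x\<^sup>2\<close> times \<open>\<integral>y. p y * (1 + sin (x - y))\<close>. If moreover the characteristic function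
  of \<open>p\<close> vanishes at frequency 1, then the latter integral does not depend on \<open>x\<close>: the oscillation of
  \<open>p\<close> disappears from its convolution square. Exponential tilting by \<open>exp (- g * x)\<close> commutes with
  convolution and turns such densities, with their regular or oscillating asymptotics,
  into measures inside or outside \<open>class_S g\<close>.
\<close>

section \<open>Densities with inverse-square decay and their tilts\<close>

definition self_conv :: "(real \<Rightarrow> real) \<Rightarrow> real \<Rightarrow> real" where
  "self_conv p x = (\<integral>y. p y * p (x - y) \<partial>lborel)"

text \<open>\<open>h\<close> is a comparison function rather than a limit, so it may oscillate. The
  global bound \<open>K\<close> supplies integrability and the dominating functions; the asymptotics
  concern \<open>at_top\<close> only.\<close>

definition inv_square_profile :: "(real \<Rightarrow> real) \<Rightarrow> (real \<Rightarrow> real) \<Rightarrow> bool" where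
  "inv_square_profile p h \<longleftrightarrow> p \<in> borel_measurable borel \<and> (\<forall>x. 0 \<le> p x) \<and>
     (\<exists>K. \<forall>x. (1 + x\<^sup>2) * p x \<le> K) \<and> ((\<lambda>x. (1 + x\<^sup>2) * p x - h x) \<longlongrightarrow> 0) at_top"

text \<open>Under this factor the exponential moment at \<open>g\<close> becomes the plain integral
  of \<open>c * p\<close>. The constant \<open>c\<close> is kept apart because convolution squares
  it.\<close>

definition tilt :: "real \<Rightarrow> real \<Rightarrow> (real \<Rightarrow> real) \<Rightarrow> real measure" where
  "tilt g c p = density lborel (\<lambda>x. ennreal (c * exp (- g * x) * p x))"

lemma one_plus_square_pos: "0 < 1 + (x::real)\<^sup>2"
  by (simp add: add_pos_nonneg)

lemma inv_square_profile_bound: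
  assumes "inv_square_profile p h"
  obtains K where "0 \<le> K" "\<And>x. (1 + x\<^sup>2) * p x \<le> K" "\<And>x. p x \<le> K"
proof -
  obtain K where K: "\<And>x. (1 + x\<^sup>2) * p x \<le> K" and nn: "\<And>x. 0 \<le> p x"
    using assms by (auto simp: inv_square_profile_def)
  have "p x \<le> K" for x
  proof -
    have "0 \<le> x\<^sup>2 * p x" using nn by simp
    then show ?thesis using K[of x] by (simp add: algebra_simps)
  qed
  moreover have "0 \<le> K" using nn[of 0] K[of 0] by simp
  ultimately show ?thesis using K that by blast
qed

lemma inv_square_profile_measurable:
  "inv_square_profile p h \<Longrightarrow> p \<in> borel_measurable borel"
  by (simp add: inv_square_profile_def)

lemma inv_square_profile_nonneg: "inv_square_profile p h \<Longrightarrow> 0 \<le> p x"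
  by (simp add: inv_square_profile_def)

lemma inv_square_profile_integrable:
  assumes "inv_square_profile p h"
  shows "integrable lborel p"
proof -
  obtain K where K: "0 \<le> K" "\<And>x. (1 + x\<^sup>2) * p x \<le> K"
    using inv_square_profile_bound[OF assms] by metis
  have "integrable lborel (\<lambda>x::real. inverse (1 + x\<^sup>2))"
    using integrable_inverse_1_plus_square by (simp add: set_integrable_def)
  then have "integrable lborel (\<lambda>x. K * inverse (1 + x\<^sup>2))" by simp
  then show ?thesis
  proof (rule Bochner_Integration.integrable_bound)
    show "p \<in> borel_measurable lborel"
      using inv_square_profile_measurable[OF assms] by simp
    have "p x \<le> K * inverse (1 + x\<^sup>2)" for x
      using K(2)[of x] one_plus_square_pos[of x] by (simp add: field_simps)
    then show "AE x in lborel. norm (p x) \<le> norm (K * inverse (1 + x\<^sup>2))"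
      using inv_square_profile_nonneg[OF assms] K(1) one_plus_square_pos
      by (auto simp: less_imp_le)
  qed
qed

text \<open>The bound is demanded only where \<open>p\<close> is nonzero, so a weight supported on a
  half-line can be paired with a factor that is controlled only there.\<close>

lemma integrable_mult_bounded:
  fixes f p :: "'a \<Rightarrow> real"
  assumes p: "integrable M p" and f: "f \<in> borel_measurable M"
    and B: "\<And>x. p x \<noteq> 0 \<Longrightarrow> \<bar>f x\<bar> \<le> B"
  shows "integrable M (\<lambda>x. p x * f x)"
proof (rule Bochner_Integration.integrable_bound)
  show "integrable M (\<lambda>x. B * p x)" using p by simp
  show "(\<lambda>x. p x * f x) \<in> borel_measurable M"
    using p f by (intro borel_measurable_times) auto
  show "AE x in M. norm (p x * f x) \<le> norm (B * p x)"
  proof (rule AE_I2)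
    fix x
    have "\<bar>p x\<bar> * \<bar>f x\<bar> \<le> \<bar>p x\<bar> * \<bar>B\<bar>"
      using B[of x] by (cases "p x = 0") (auto intro!: mult_left_mono)
    then show "norm (p x * f x) \<le> norm (B * p x)"
      by (simp add: abs_mult mult.commute)
  qed
qed

section \<open>Asymptotics of the self-convolution\<close>

lemma integrable_self_conv_integrand:
  assumes "inv_square_profile p h"
  shows "integrable lborel (\<lambda>y. p y * p (x - y))"
proof -
  note [measurable] = inv_square_profile_measurable[OF assms]
  obtain K where K: "0 \<le> K" "\<And>x. p x \<le> K"
    using inv_square_profile_bound[OF assms] by metis
  show ?thesis
    using K inv_square_profile_nonneg[OF assms]
    by (intro integrable_mult_bounded[OF inv_square_profile_integrable[OF assms], where B = K]) auto
qed

text \<open>The weights of \<open>y\<close> and \<open>x - y\<close> add up to 1; the weight tames the slowly decaying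
  factor \<open>p (x - y)\<close>, so that no splitting of the range at \<open>x / 2\<close> is needed.\<close>

lemma self_conv_weighted:
  assumes "inv_square_profile p h"
  shows "self_conv p x =
    2 * (\<integral>y. p y * p (x - y) * ((1 + (x - y)\<^sup>2) / (2 + y\<^sup>2 + (x - y)\<^sup>2)) \<partial>lborel)"
proof -
  define w where "w y = (1 + (x - y)\<^sup>2) / (2 + y\<^sup>2 + (x - y)\<^sup>2)" for y
  have pos: "0 < 2 + y\<^sup>2 + (x - y)\<^sup>2" for y
    by (intro add_pos_nonneg) auto
  have w01: "0 \<le> w y" "w y \<le> 1" for y
    using pos[of y] unfolding w_def by (auto intro!: divide_nonneg_pos)
  have w1: "w y + w (x - y) = 1" for y
  proof -
    have "w y + w (x - y) = (2 + y\<^sup>2 + (x - y)\<^sup>2) / (2 + y\<^sup>2 + (x - y)\<^sup>2)"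
      unfolding w_def by (simp add: add_divide_distrib[symmetric] add_ac)
    then show ?thesis using pos[of y] by simp
  qed
  note [measurable] = inv_square_profile_measurable[OF assms]
  have [measurable]: "w \<in> borel_measurable borel" unfolding w_def by measurable
  have int: "integrable lborel (\<lambda>y. p y * p (x - y) * v y)"
    if [measurable]: "v \<in> borel_measurable borel" and v: "\<And>y. 0 \<le> v y" "\<And>y. v y \<le> 1" for v
    using v by (intro integrable_mult_bounded[OF integrable_self_conv_integrand[OF assms], where B = 1]) auto
  have "self_conv p x = (\<integral>y. p y * p (x - y) * w y + p y * p (x - y) * w (x - y) \<partial>lborel)"
    unfolding self_conv_def distrib_left[symmetric] w1 by simp
  also have "\<dots> = (\<integral>y. p y * p (x - y) * w y \<partial>lborel) + (\<integral>y. p y * p (x - y) * w (x - y) \<partial>lborel)"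
    by (intro Bochner_Integration.integral_add int) (auto simp: w01)
  \<comment> \<open>The reflection \<open>y\<close> to \<open>x - y\<close> exchanges the two
    factors \<open>p\<close>, so both weighted halves are equal.\<close>
  also have "(\<integral>y. p y * p (x - y) * w (x - y) \<partial>lborel) = (\<integral>y. p y * p (x - y) * w y \<partial>lborel)"
    by (subst lborel_integral_real_affine[where c = "-1" and t = x]) (auto simp: mult_ac)
  finally show ?thesis by (simp add: w_def)
qed

text \<open>After expansion this rests on \<open>(x - 2 * y)\<^sup>2 \<ge> 0\<close>. It makes the
  domination for the self-convolution uniform in \<open>x\<close>.\<close>

lemma weight_le_two: "(1 + x\<^sup>2) / (2 + y\<^sup>2 + (x - y)\<^sup>2) \<le> (2::real)"
proof -
  have "0 \<le> (x - 2 * y)\<^sup>2" by simp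
  then have "1 + x\<^sup>2 \<le> 2 * (2 + y\<^sup>2 + (x - y)\<^sup>2)"
    by (simp add: power2_eq_square algebra_simps)
  moreover have "0 < 2 + y\<^sup>2 + (x - y)\<^sup>2" by (intro add_pos_nonneg) auto
  ultimately show ?thesis by (simp add: divide_le_eq)
qed

text \<open>By the weighted formula, \<open>(1 + x\<^sup>2) * self_conv p x\<close> is twice an
  integral of \<open>p y\<close> against a bounded factor that approaches \<open>h (x - y)\<close>
  for each fixed \<open>y\<close>. Dominated convergence with a multiple of \<open>p\<close> then
  gives the new profile.\<close>

lemma inv_square_profile_self_conv:
  assumes p: "inv_square_profile p h" and [measurable]: "h \<in> borel_measurable borel"
    and H: "\<And>x. \<bar>h x\<bar> \<le> H"
  shows "inv_square_profile (self_conv p) (\<lambda>x. 2 * (\<integral>y. p y * h (x - y) \<partial>lborel))"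
proof -
  note [measurable] = inv_square_profile_measurable[OF p]
  note int = inv_square_profile_integrable[OF p]
  note nn = inv_square_profile_nonneg[OF p]
  obtain K where K: "0 \<le> K" "\<And>x. (1 + x\<^sup>2) * p x \<le> K"
    using inv_square_profile_bound[OF p] by metis
  define m where "m x = (1 + x\<^sup>2) * p x" for x
  define R where "R x y = (1 + x\<^sup>2) / (2 + y\<^sup>2 + (x - y)\<^sup>2)" for x y :: real
  have m: "0 \<le> m x" "m x \<le> K" for x
    using K nn by (auto simp: m_def)
  have lim: "((\<lambda>x. m x - h x) \<longlongrightarrow> 0) at_top"
    using p by (simp add: inv_square_profile_def m_def)
  have R: "0 \<le> R x y" "R x y \<le> 2" for x y
    using weight_le_two by (auto simp: R_def)
  have mR: "m (x - y) * R x y \<le> K * 2" "0 \<le> m (x - y) * R x y" for x y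
    using m R K by (auto intro!: mult_mono)
  have [measurable]: "m \<in> borel_measurable borel" unfolding m_def by measurable
  have [measurable]: "R x \<in> borel_measurable borel" for x unfolding R_def by measurable
  have i1: "integrable lborel (\<lambda>y. p y * (m (x - y) * R x y))" for x
    by (rule integrable_mult_bounded[OF int, where B = "K * 2"]) (use mR in auto)
  have i2: "integrable lborel (\<lambda>y. p y * h (x - y))" for x
    by (rule integrable_mult_bounded[OF int, where B = H]) (use H in auto)
  \<comment> \<open>The numerator of the weight turns \<open>p (x - y)\<close> into the bounded
    \<open>m (x - y)\<close>; the prefactor \<open>1 + x\<^sup>2\<close> over the denominator of the
    weight is \<open>R x y\<close>.\<close>
  have eq: "(1 + x\<^sup>2) * self_conv p x = 2 * (\<integral>y. p y * (m (x - y) * R x y) \<partial>lborel)" for x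
    unfolding self_conv_weighted[OF p] m_def R_def
    by (simp add: integral_mult_right_zero[symmetric] mult_ac del: integral_mult_right_zero)
  have bound: "(1 + x\<^sup>2) * self_conv p x \<le> 2 * (\<integral>y. p y * (K * 2) \<partial>lborel)" for x
    unfolding eq using mR nn int i1
    by (intro mult_left_mono integral_mono) (auto intro!: mult_left_mono)
  have "((\<lambda>x. \<integral>y. p y * (m (x - y) * R x y - h (x - y)) \<partial>lborel) \<longlongrightarrow> integral\<^sup>L lborel (\<lambda>y::real. 0)) at_top"
  proof (rule integral_dominated_convergence_at_top[where w = "\<lambda>y. p y * (K * 2 + H)"])
    show "AE y in lborel. ((\<lambda>x. p y * (m (x - y) * R x y - h (x - y))) \<longlongrightarrow> 0) at_top"
    proof (rule AE_I2)
      fix y :: real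
      have shift: "filterlim (\<lambda>x. x - y) at_top at_top" by real_asymp
      have 1: "((\<lambda>x. m (x - y) - h (x - y)) \<longlongrightarrow> 0) at_top"
        using filterlim_compose[OF lim shift] .
      have "((\<lambda>x. R x y - 1) \<longlongrightarrow> 0) at_top" unfolding R_def by real_asymp
      then have 2: "((\<lambda>x. m (x - y) * (R x y - 1)) \<longlongrightarrow> 0) at_top"
        by (rule lim_null_mult_left_bounded[where B = K, rotated])
           (use m in \<open>auto simp: abs_of_nonneg\<close>)
      \<comment> \<open>Split the error: \<open>R x y\<close> tends to 1 for fixed \<open>y\<close>
        while \<open>m\<close> stays bounded, and \<open>m - h\<close> vanishes at
        \<open>x - y\<close>.\<close>
      have "((\<lambda>x. p y * (m (x - y) * (R x y - 1) + (m (x - y) - h (x - y)))) \<longlongrightarrow> p y * (0 + 0)) at_top"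
        by (intro tendsto_intros 1 2)
      then show "((\<lambda>x. p y * (m (x - y) * R x y - h (x - y))) \<longlongrightarrow> 0) at_top"
        by (simp add: algebra_simps)
    qed
    show "\<forall>\<^sub>F x in at_top. AE y in lborel. norm (p y * (m (x - y) * R x y - h (x - y))) \<le> p y * (K * 2 + H)"
    proof (intro always_eventually allI AE_I2)
      fix x y
      have "\<bar>m (x - y) * R x y - h (x - y)\<bar> \<le> K * 2 + H"
        using mR[of x y] H[of "x - y"] by linarith
      then show "norm (p y * (m (x - y) * R x y - h (x - y))) \<le> p y * (K * 2 + H)"
        using nn[of y] by (auto simp: abs_mult intro!: mult_left_mono)
    qed
  qed (use int in auto)
  then have "((\<lambda>x. 2 * (\<integral>y. p y * (m (x - y) * R x y - h (x - y)) \<partial>lborel)) \<longlongrightarrow> 2 * 0) at_top"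
    by (intro tendsto_mult_left) simp
  moreover have "2 * (\<integral>y. p y * (m (x - y) * R x y - h (x - y)) \<partial>lborel) =
      (1 + x\<^sup>2) * self_conv p x - 2 * (\<integral>y. p y * h (x - y) \<partial>lborel)" for x
    unfolding eq using Bochner_Integration.integral_diff[OF i1[of x] i2[of x]]
    by (simp add: right_diff_distrib)
  moreover have "self_conv p \<in> borel_measurable borel"
    unfolding self_conv_def[abs_def] by measurable
  moreover have "0 \<le> self_conv p x" for x
    unfolding self_conv_def by (simp add: nn)
  ultimately show ?thesis
    using bound by (auto simp: inv_square_profile_def)
qed

section \<open>Convolution and exponential moment of tilted measures\<close>

lemma sets_tilt [simp]: "sets (tilt g c p) = sets borel"
  by (simp add: tilt_def)

text \<open>The exponents at \<open>x - y\<close> and \<open>y\<close> add up to the exponent at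
  \<open>x\<close>, which is free of \<open>y\<close>; the exponential therefore leaves the
  convolution integral as a common factor.\<close>

lemma tilt_convolution:
  assumes p: "inv_square_profile p h" and "0 \<le> c" and fin: "finite_measure (tilt g c p)"
  shows "convolution (tilt g c p) (tilt g c p) = tilt g (c\<^sup>2) (self_conv p)"
proof -
  note [measurable] = inv_square_profile_measurable[OF p]
  note nn = inv_square_profile_nonneg[OF p]
  have "(\<integral>\<^sup>+y. ennreal (c * exp (- g * (x - y)) * p (x - y)) * ennreal (c * exp (- g * y) * p y) \<partial>lborel)
      = ennreal (c\<^sup>2 * exp (- g * x) * self_conv p x)" for x
  proof -
    have "c * exp (- g * (x - y)) * p (x - y) * (c * exp (- g * y) * p y) =
        c\<^sup>2 * exp (- g * x) * (p y * p (x - y))" for y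
    proof -
      have "exp (- g * x) = exp (- g * (x - y)) * exp (- g * y)"
        by (simp add: exp_add[symmetric] algebra_simps)
      then show ?thesis unfolding power2_eq_square by (simp only: mult_ac)
    qed
    then have "(\<integral>\<^sup>+y. ennreal (c * exp (- g * (x - y)) * p (x - y)) * ennreal (c * exp (- g * y) * p y) \<partial>lborel)
      = (\<integral>\<^sup>+y. ennreal (c\<^sup>2 * exp (- g * x) * (p y * p (x - y))) \<partial>lborel)"
      using nn \<open>0 \<le> c\<close> by (intro nn_integral_cong) (subst ennreal_mult'[symmetric], auto)
    also have "\<dots> = ennreal (\<integral>y. c\<^sup>2 * exp (- g * x) * (p y * p (x - y)) \<partial>lborel)"
      using nn integrable_self_conv_integrand[OF p]
      by (intro nn_integral_eq_integral integrable_mult_right) auto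
    finally show ?thesis by (simp add: self_conv_def)
  qed
  then show ?thesis
    using fin unfolding tilt_def by (subst convolution_density) auto
qed

text \<open>\<open>conv_pow\<close> recurses down to the unit mass at 0, so the content is that this
  point mass is neutral for convolution.\<close>

lemma conv_pow_2:
  assumes "finite_measure M" and sets: "sets M = sets borel"
  shows "conv_pow M 2 = convolution M M"
proof -
  note [measurable_cong] = sets
  have "convolution M (return borel 0) = M"
  proof (rule measure_eqI)
    fix A assume "A \<in> sets (convolution M (return borel 0))"
    then have [measurable]: "A \<in> sets borel" by simp
    interpret r: prob_space "return borel (0::real)" by (rule prob_space_return) simp
    have "emeasure (convolution M (return borel 0)) A = (\<integral>\<^sup>+x. \<integral>\<^sup>+y. indicator A (x + y) \<partial>return borel 0 \<partial>M)"
      using assms by (intro convolution_emeasure') (auto intro: r.finite_measure_axioms)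
    also have "\<dots> = (\<integral>\<^sup>+x. indicator A x \<partial>M)"
      by (subst nn_integral_return) auto
    also have "\<dots> = emeasure M A" using sets by simp
    finally show "emeasure (convolution M (return borel 0)) A = emeasure M A" .
  qed (simp add: sets)
  then show ?thesis by (simp add: numeral_2_eq_2)
qed

lemma mgf_tilt:
  assumes p: "inv_square_profile p h" and "0 \<le> c"
  shows "mgf (tilt g c p) g = ennreal (c * (\<integral>x. p x \<partial>lborel))"
proof -
  note [measurable] = inv_square_profile_measurable[OF p]
  note nn = inv_square_profile_nonneg[OF p]
  have "mgf (tilt g c p) g = (\<integral>\<^sup>+x. ennreal (c * exp (- g * x) * p x) * ennreal (exp (g * x)) \<partial>lborel)"
    unfolding mgf_def tilt_def by (subst nn_integral_density) auto
  also have "\<dots> = (\<integral>\<^sup>+x. ennreal (c * p x) \<partial>lborel)"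
    using nn \<open>0 \<le> c\<close>
    by (intro nn_integral_cong) (simp add: ennreal_mult'[symmetric] exp_minus field_simps)
  also have "\<dots> = ennreal (c * (\<integral>x. p x \<partial>lborel))"
    using nn \<open>0 \<le> c\<close> inv_square_profile_integrable[OF p] by (subst nn_integral_eq_integral) auto
  finally show ?thesis .
qed

section \<open>Tails of tilted measures\<close>

lemma integrable_exp_decay:
  assumes "0 < g"
  shows "integrable lborel (\<lambda>s. indicator {0<..} s * exp (- g * s) :: real)"
  using integrable_I0i_exp_mscale[OF assms] by (simp add: set_integrable_def mult.commute)

lemma integral_exp_decay:
  fixes g :: real
  assumes "0 < g"
  shows "(\<integral>s. indicator {0<..} s * exp (- g * s) \<partial>lborel) = 1 / g"
  using LBINT_I0i_exp_mscale[of g] assms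
  by (simp add: interval_lebesgue_integral_0_infty set_lebesgue_integral_def mult.commute)

text \<open>The shift \<open>t = x + s\<close> pulls out \<open>exp (- g * x)\<close> and leaves an
  exponentially weighted average of \<open>p\<close> to the right of \<open>x\<close>.\<close>

lemma tail_tilt:
  assumes p: "inv_square_profile p h" and "0 \<le> c"
  shows "tail (tilt g c p) x = c * exp (- g * x) * (\<integral>s. indicator {0<..} s * exp (- g * s) * p (x + s) \<partial>lborel)"
proof -
  note [measurable] = inv_square_profile_measurable[OF p]
  note nn = inv_square_profile_nonneg[OF p]
  have "tail (tilt g c p) x = (\<integral>t. indicator {x<..} t \<partial>tilt g c p)"
    by (simp add: tail_def tilt_def)
  also have "\<dots> = (\<integral>t. c * exp (- g * t) * p t * indicator {x<..} t \<partial>lborel)"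
    unfolding tilt_def using nn \<open>0 \<le> c\<close> by (subst integral_density) auto
  also have "\<dots> = (\<integral>s. c * exp (- g * (x + s)) * p (x + s) * indicator {x<..} (x + s) \<partial>lborel)"
    by (subst lborel_integral_real_affine[where c = 1 and t = x]) auto
  also have "\<dots> = (\<integral>s. c * exp (- g * x) * (indicator {0<..} s * exp (- g * s) * p (x + s)) \<partial>lborel)"
    by (intro Bochner_Integration.integral_cong)
       (auto simp: indicator_def distrib_left exp_add[symmetric] algebra_simps)
  finally show ?thesis by simp
qed

text \<open>Dominated convergence against the exponential weight: for fixed \<open>s\<close>,
  trading \<open>1 + (x + s)\<^sup>2\<close> for \<open>1 + x\<^sup>2\<close> costs a factor tending
  to 1. The average of \<open>h\<close> still depends on \<open>x\<close>, since \<open>h\<close>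
  may oscillate.\<close>

lemma tail_tilt_asymptotics:
  assumes p: "inv_square_profile p h" and [measurable]: "h \<in> borel_measurable borel"
    and H: "\<And>x. \<bar>h x\<bar> \<le> H" and "0 \<le> c" and "0 < g"
  shows "((\<lambda>x. (1 + x\<^sup>2) * exp (g * x) * tail (tilt g c p) x -
      c * (\<integral>s. indicator {0<..} s * exp (- g * s) * h (x + s) \<partial>lborel)) \<longlongrightarrow> 0) at_top"
proof -
  note [measurable] = inv_square_profile_measurable[OF p]
  note nn = inv_square_profile_nonneg[OF p]
  note int = integrable_exp_decay[OF \<open>0 < g\<close>]
  obtain K where K: "0 \<le> K" "\<And>x. (1 + x\<^sup>2) * p x \<le> K"
    using inv_square_profile_bound[OF p] by metis
  define e :: "real \<Rightarrow> real" where "e s = indicator {0<..} s * exp (- g * s)" for s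
  define m where "m x = (1 + x\<^sup>2) * p x" for x
  define R where "R x s = (1 + x\<^sup>2) / (1 + (x + s)\<^sup>2)" for x s :: real
  have m: "0 \<le> m x" "m x \<le> K" for x
    using K nn by (auto simp: m_def)
  have lim: "((\<lambda>x. m x - h x) \<longlongrightarrow> 0) at_top"
    using p by (simp add: inv_square_profile_def m_def)
  have e: "0 \<le> e s" "\<not> 0 < s \<Longrightarrow> e s = 0" for s by (auto simp: e_def)
  have inte: "integrable lborel e" using int by (simp add: e_def[abs_def])
  have [measurable]: "m \<in> borel_measurable borel" "e \<in> borel_measurable borel"
    "R x \<in> borel_measurable borel" for x
    unfolding m_def[abs_def] e_def[abs_def] R_def[abs_def] by measurable
  \<comment> \<open>For \<open>0 \<le> x\<close> and \<open>0 < s\<close> the denominator exceeds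
    the numerator. For negative \<open>x\<close> this can fail, so the domination below is claimed
    only eventually.\<close>
  have R: "0 \<le> R x s" "0 \<le> x \<Longrightarrow> 0 < s \<Longrightarrow> R x s \<le> 1" for x s
    using one_plus_square_pos[of "x + s"] by (auto simp: R_def intro!: power_mono)
  have mR: "0 \<le> m (x + s) * R x s" "0 \<le> x \<Longrightarrow> 0 < s \<Longrightarrow> m (x + s) * R x s \<le> K" for x s
    using m[of "x + s"] R[of x s] mult_mono[of "m (x + s)" K "R x s" 1] by auto
  have mR_eq: "m (x + s) * R x s = (1 + x\<^sup>2) * p (x + s)" for x s
    using one_plus_square_pos[of "x + s"] by (simp add: m_def R_def)
  have i1: "integrable lborel (\<lambda>s. e s * (m (x + s) * R x s))" if "0 \<le> x" for x
    using mR[of x] e that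
    by (intro integrable_mult_bounded[OF inte, where B = K]) (auto simp: abs_of_nonneg)
  have i2: "integrable lborel (\<lambda>s. e s * h (x + s))" for x
    by (rule integrable_mult_bounded[OF inte, where B = H]) (use H in auto)
  have eq: "(1 + x\<^sup>2) * exp (g * x) * tail (tilt g c p) x = c * (\<integral>s. e s * (m (x + s) * R x s) \<partial>lborel)" for x
  proof -
    have "(\<integral>s. e s * (m (x + s) * R x s) \<partial>lborel) = (\<integral>s. (1 + x\<^sup>2) * (e s * p (x + s)) \<partial>lborel)"
      unfolding mR_eq by (simp add: mult_ac)
    then show ?thesis
      unfolding tail_tilt[OF p \<open>0 \<le> c\<close>] e_def[symmetric] by (simp add: exp_minus)
  qed
  have "((\<lambda>x. \<integral>s. e s * (m (x + s) * R x s - h (x + s)) \<partial>lborel) \<longlongrightarrow> integral\<^sup>L lborel (\<lambda>s::real. 0)) at_top"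
  proof (rule integral_dominated_convergence_at_top[where w = "\<lambda>s. e s * (K + H)"])
    show "AE s in lborel. ((\<lambda>x. e s * (m (x + s) * R x s - h (x + s))) \<longlongrightarrow> 0) at_top"
    proof (rule AE_I2)
      fix s :: real
      have shift: "filterlim (\<lambda>x. x + s) at_top at_top" by real_asymp
      have 1: "((\<lambda>x. m (x + s) - h (x + s)) \<longlongrightarrow> 0) at_top"
        using filterlim_compose[OF lim shift] .
      have "((\<lambda>x. R x s - 1) \<longlongrightarrow> 0) at_top" unfolding R_def by real_asymp
      then have 2: "((\<lambda>x. m (x + s) * (R x s - 1)) \<longlongrightarrow> 0) at_top"
        by (rule lim_null_mult_left_bounded[where B = K, rotated])
           (use m in \<open>auto simp: abs_of_nonneg\<close>)
      have "((\<lambda>x. e s * (m (x + s) * (R x s - 1) + (m (x + s) - h (x + s)))) \<longlongrightarrow> e s * (0 + 0)) at_top"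
        by (intro tendsto_intros 1 2)
      then show "((\<lambda>x. e s * (m (x + s) * R x s - h (x + s))) \<longlongrightarrow> 0) at_top"
        by (simp add: algebra_simps)
    qed
    show "\<forall>\<^sub>F x in at_top. AE s in lborel. norm (e s * (m (x + s) * R x s - h (x + s))) \<le> e s * (K + H)"
    proof (rule eventually_mono[OF eventually_ge_at_top[of 0]], rule AE_I2)
      fix x s :: real assume "0 \<le> x"
      then have "\<bar>m (x + s) * R x s - h (x + s)\<bar> \<le> K + H" if "0 < s"
        using mR[of x s] H[of "x + s"] that by linarith
      then show "norm (e s * (m (x + s) * R x s - h (x + s))) \<le> e s * (K + H)"
        using e[of s] by (cases "0 < s") (auto simp: abs_mult intro!: mult_left_mono)
    qed
  qed (use inte in auto)
  then have lim0: "((\<lambda>x. c * (\<integral>s. e s * (m (x + s) * R x s - h (x + s)) \<partial>lborel)) \<longlongrightarrow> c * 0) at_top"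
    by (intro tendsto_mult_left) simp
  have "c * (\<integral>s. e s * (m (x + s) * R x s - h (x + s)) \<partial>lborel) =
      (1 + x\<^sup>2) * exp (g * x) * tail (tilt g c p) x - c * (\<integral>s. e s * h (x + s) \<partial>lborel)" if "0 \<le> x" for x
    unfolding eq using Bochner_Integration.integral_diff[OF i1[OF that] i2[of x]]
    by (simp add: right_diff_distrib)
  then have "\<forall>\<^sub>F x in at_top. c * (\<integral>s. e s * (m (x + s) * R x s - h (x + s)) \<partial>lborel) =
      (1 + x\<^sup>2) * exp (g * x) * tail (tilt g c p) x - c * (\<integral>s. e s * h (x + s) \<partial>lborel)"
    using eventually_ge_at_top[of 0] by (rule eventually_mono[rotated])
  from Lim_transform_eventually[OF lim0 this] show ?thesis by (simp add: e_def)
qed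

text \<open>A constant profile has the constant average \<open>d / g\<close>; as it is nonzero, a
  difference tending to 0 upgrades to an asymptotic equivalence.\<close>

lemma tail_tilt_equiv:
  assumes p: "inv_square_profile p (\<lambda>_. d)" and "0 \<le> c" "0 < g" "d \<noteq> 0" "c \<noteq> 0"
  shows "tail (tilt g c p) \<sim>[at_top] (\<lambda>x. c * d / g * (exp (- g * x) / (1 + x\<^sup>2)))"
proof -
  have "((\<lambda>x. (1 + x\<^sup>2) * exp (g * x) * tail (tilt g c p) x - c * d / g) \<longlongrightarrow> 0) at_top"
    using tail_tilt_asymptotics[OF p _ order_refl \<open>0 \<le> c\<close> \<open>0 < g\<close>] integral_exp_decay[OF \<open>0 < g\<close>]
    by simp
  then have "((\<lambda>x. (1 + x\<^sup>2) * exp (g * x) * tail (tilt g c p) x) \<longlongrightarrow> c * d / g) at_top"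
    by (simp add: LIM_zero_iff)
  then have "((\<lambda>x. (1 + x\<^sup>2) * exp (g * x) * tail (tilt g c p) x / (c * d / g)) \<longlongrightarrow> 1) at_top"
    using tendsto_divide[OF _ tendsto_const, of _ "c * d / g" at_top "c * d / g"] assms by fastforce
  then have "((\<lambda>x. tail (tilt g c p) x / (c * d / g * (exp (- g * x) / (1 + x\<^sup>2)))) \<longlongrightarrow> 1) at_top"
    by (simp add: exp_minus divide_inverse mult_ac)
  then show ?thesis by (rule asymp_equivI')
qed

section \<open>Constant profiles give members of \<open>class_S\<close>\<close>

text \<open>Both tails are multiples of the same explicit \<open>f\<close>. The profile
  \<open>d\<close> becomes \<open>2 * Q * d\<close> under self-convolution and \<open>c\<close>
  becomes \<open>c\<^sup>2\<close>, so the ratio of the tails tends to \<open>2 * c * Q\<close>,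
  where \<open>c * Q\<close> is the exponential moment.\<close>

lemma class_S_tilt:
  assumes p: "inv_square_profile p (\<lambda>_. d)" and c: "0 < c" and g: "0 < g" and d: "0 < d"
    and P: "0 < (\<integral>x. p x \<partial>lborel)"
    and fin: "finite_measure (tilt g c p)"
  shows "class_S g (tilt g c p)"
proof -
  define Q where "Q = (\<integral>x. p x \<partial>lborel)"
  define f where "f x = exp (- g * x) / (1 + x\<^sup>2)" for x
  have fpos: "0 < f x" for x by (simp add: f_def one_plus_square_pos)
  have T: "tail (tilt g c p) \<sim>[at_top] (\<lambda>x. c * d / g * f x)"
    unfolding f_def using tail_tilt_equiv[OF p] c g d by simp
  \<comment> \<open>The equivalence yields nonzero tails only far out; monotonicity of the tail
    carries positivity back to every \<open>x\<close>.\<close>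
  have pos: "0 < tail (tilt g c p) x" for x
  proof -
    interpret finite_measure "tilt g c p" by fact
    have "\<forall>\<^sub>F y in at_top. tail (tilt g c p) y \<noteq> 0 \<longleftrightarrow> c * d / g * f y \<noteq> 0"
      using asymp_equiv_eventually_zeros[OF T] by eventually_elim auto
    then have "\<forall>\<^sub>F y in at_top. tail (tilt g c p) y \<noteq> 0"
      using c g d fpos by (simp add: less_imp_neq[symmetric])
    then obtain y where "x \<le> y" "tail (tilt g c p) y \<noteq> 0"
      using eventually_happens[OF eventually_conj[OF _ eventually_ge_at_top[of x]]] by fastforce
    moreover have "tail (tilt g c p) y \<le> tail (tilt g c p) x"
      unfolding tail_def using \<open>x \<le> y\<close> by (intro finite_measure_mono) auto
    ultimately show ?thesis by (smt (verit) measure_nonneg tail_def)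
  qed
  have L: "class_L g (tilt g c p)"
    unfolding class_L_def
  proof (intro conjI allI pos)
    fix a :: real
    \<comment> \<open>The exponential contributes the required factor exactly, and the quadratic
      denominator is asymptotically insensitive to shifts.\<close>
    have f: "(\<lambda>x. f (x + a)) \<sim>[at_top] (\<lambda>x. exp (- g * a) * f x)"
    proof (rule asymp_equivI')
      have "f (x + a) / (exp (- g * a) * f x) = (1 + x\<^sup>2) / (1 + (x + a)\<^sup>2)" for x
      proof -
        have "exp (- g * (x + a)) = exp (- g * a) * exp (- g * x)"
          by (simp add: exp_add[symmetric] algebra_simps)
        then show ?thesis by (simp add: f_def)
      qed
      then show "((\<lambda>x. f (x + a) / (exp (- g * a) * f x)) \<longlongrightarrow> 1) at_top"
        by simp real_asymp
    qed
    have "filterlim (\<lambda>x::real. x + a) at_top at_top" by real_asymp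
    from asymp_equiv_compose[OF T this]
    have "(\<lambda>x. tail (tilt g c p) (x + a)) \<sim>[at_top] (\<lambda>x. c * d / g * f (x + a))"
      by (simp add: o_def)
    also have "(\<lambda>x. c * d / g * f (x + a)) \<sim>[at_top] (\<lambda>x. c * d / g * (exp (- g * a) * f x))"
      by (intro asymp_equiv_mult asymp_equiv_refl f)
    also have "(\<lambda>x. c * d / g * (exp (- g * a) * f x)) = (\<lambda>x. exp (- g * a) * (c * d / g * f x))"
      by (simp only: mult.left_commute)
    also have "(\<lambda>x. exp (- g * a) * (c * d / g * f x)) \<sim>[at_top] (\<lambda>x. exp (- g * a) * tail (tilt g c p) x)"
      by (intro asymp_equiv_mult asymp_equiv_refl asymp_equiv_symI[OF T])
    finally show "(\<lambda>x. tail (tilt g c p) (x + a)) \<sim>[at_top] (\<lambda>x. exp (- g * a) * tail (tilt g c p) x)" .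
  qed
  have m: "mgf (tilt g c p) g = ennreal (c * Q)"
    using mgf_tilt[OF p] c by (simp add: Q_def)
  have "inv_square_profile (self_conv p) (\<lambda>x. 2 * (Q * d))"
    using inv_square_profile_self_conv[OF p _ order_refl] by (simp add: Q_def)
  then have "tail (tilt g (c\<^sup>2) (self_conv p)) \<sim>[at_top] (\<lambda>x. c\<^sup>2 * (2 * (Q * d)) / g * f x)"
    unfolding f_def using c g d P by (intro tail_tilt_equiv) (auto simp: Q_def)
  also have "tilt g (c\<^sup>2) (self_conv p) = conv_pow (tilt g c p) 2"
    using tilt_convolution[OF p _ fin] conv_pow_2[OF fin] c by simp
  also have "(\<lambda>x. c\<^sup>2 * (2 * (Q * d)) / g * f x) = (\<lambda>x. 2 * (c * Q) * (c * d / g * f x))"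
    by (simp add: power2_eq_square mult_ac)
  also have "\<dots> \<sim>[at_top] (\<lambda>x. 2 * (c * Q) * tail (tilt g c p) x)"
    by (intro asymp_equiv_mult asymp_equiv_refl asymp_equiv_symI[OF T])
  finally have "(\<lambda>x. tail (conv_pow (tilt g c p) 2) x) \<sim>[at_top]
      (\<lambda>x. 2 * enn2real (mgf (tilt g c p) g) * tail (tilt g c p) x)"
    using c P by (simp add: m Q_def)
  then show ?thesis
    using L m by (simp add: class_S_def)
qed

section \<open>An oscillating profile violates \<open>class_L\<close>\<close>

lemma integral_exp_decay_sin:
  \<comment> \<open>This is the imaginary part of the Laplace transform \<open>1 / (g - i)\<close>.
    Its being nonzero means that exponential averaging does not wipe out the oscillation.\<close>
  fixes g :: real
  assumes g: "0 < g"
  shows "(\<integral>s. indicator {0<..} s * exp (- g * s) * sin s \<partial>lborel) = 1 / (1 + g\<^sup>2)"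
proof -
  let ?f = "\<lambda>s. indicator {0<..} s * exp (- g * s) * sin s"
  let ?F = "\<lambda>t. - (exp (- g * t) * (g * sin t + cos t)) / (1 + g\<^sup>2)"
  have int: "integrable lborel ?f"
    by (rule integrable_mult_bounded[OF integrable_exp_decay[OF g], where B = 1]) auto
  have "((\<lambda>t. \<integral>s. indicator {..t} s *\<^sub>R ?f s \<partial>lborel) \<longlongrightarrow> integral\<^sup>L lborel ?f) at_top"
    using int by (intro tendsto_integral_at_top) auto
  moreover have "(\<integral>s. indicator {..t} s *\<^sub>R ?f s \<partial>lborel) = ?F t - ?F 0" if "0 \<le> t" for t
  proof -
    have "(\<integral>s. indicator {..t} s *\<^sub>R ?f s \<partial>lborel) = (\<integral>s. exp (- g * s) * sin s * indicator {0..t} s \<partial>lborel)"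
      by (intro Bochner_Integration.integral_cong) (auto simp: indicator_def)
    also have "\<dots> = ?F t - ?F 0"
    proof (rule integral_FTC_Icc_real[OF that])
      fix s :: real
      have "(?F has_real_derivative
          - (exp (- g * s) * (g * cos s - sin s) - g * exp (- g * s) * (g * sin s + cos s)) / (1 + g\<^sup>2)) (at s)"
        by (rule DERIV_cdivide, rule DERIV_minus)
           (auto intro!: derivative_eq_intros simp: algebra_simps)
      also have "- (exp (- g * s) * (g * cos s - sin s) - g * exp (- g * s) * (g * sin s + cos s)) =
          (1 + g\<^sup>2) * (exp (- g * s) * sin s)"
        by (simp add: power2_eq_square algebra_simps)
      finally show "(?F has_real_derivative exp (- g * s) * sin s) (at s)"
        using one_plus_square_pos[of g] by simp
    qed (auto intro!: continuous_intros)
    finally show ?thesis .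
  qed
  then have "\<forall>\<^sub>F t in at_top. (\<integral>s. indicator {..t} s *\<^sub>R ?f s \<partial>lborel) = ?F t - ?F 0"
    using eventually_ge_at_top[of 0] by (rule eventually_mono[rotated])
  ultimately have 1: "((\<lambda>t. ?F t - ?F 0) \<longlongrightarrow> integral\<^sup>L lborel ?f) at_top"
    by (rule Lim_transform_eventually)
  have "((\<lambda>t. exp (- g * t) * (g * sin t + cos t)) \<longlongrightarrow> 0) at_top"
  proof (rule lim_null_mult_right_bounded[where B = "g + 1"])
    show "((\<lambda>t. exp (- g * t)) \<longlongrightarrow> 0) at_top" using g by real_asymp
    show "\<forall>\<^sub>F t in at_top. norm (g * sin t + cos t) \<le> g + 1"
    proof (rule always_eventually, rule allI)
      fix t
      have "\<bar>g * sin t\<bar> \<le> g" using g by (simp add: abs_mult mult_left_le)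
      then show "norm (g * sin t + cos t) \<le> g + 1"
        using abs_cos_le_one[of t] by (simp only: real_norm_def)
    qed
  qed
  then have "((\<lambda>t. ?F t - ?F 0) \<longlongrightarrow> - 0 / (1 + g\<^sup>2) - ?F 0) at_top"
    using one_plus_square_pos[of g] by (intro tendsto_intros) simp_all
  then have "((\<lambda>t. ?F t - ?F 0) \<longlongrightarrow> 1 / (1 + g\<^sup>2)) at_top" by simp
  with 1 show ?thesis by (intro tendsto_unique) auto
qed

lemma not_class_L_tilt_sin:
  \<comment> \<open>The normalised tail \<open>G\<close> has different limits along whole periods
    and along whole periods plus \<open>pi\<close>, whereas \<open>class_L\<close> with shift
    \<open>pi\<close> would force these limits to agree.\<close>
  assumes p: "inv_square_profile p (\<lambda>x. 1 + sin x)" and c: "0 < c" and g: "0 < g"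
  shows "\<not> class_L g (tilt g c p)"
proof
  assume L: "class_L g (tilt g c p)"
  define e :: "real \<Rightarrow> real" where "e s = indicator {0<..} s * exp (- g * s)" for s
  define J where "J x = (\<integral>s. e s * (1 + sin (x + s)) \<partial>lborel)" for x
  define S where "S = (\<integral>s. e s * sin s \<partial>lborel)"
  define G where "G x = (1 + x\<^sup>2) * exp (g * x) * tail (tilt g c p) x" for x
  define X where "X n = 2 * pi * real n" for n
  have inte: "integrable lborel e"
    using integrable_exp_decay[OF g] by (simp add: e_def[abs_def])
  have ints: "integrable lborel (\<lambda>s. e s * sin s)"
    by (rule integrable_mult_bounded[OF inte, where B = 1]) auto
  have e1: "(\<integral>s. e s \<partial>lborel) = 1 / g"
    using integral_exp_decay[OF g] by (simp add: e_def)
  \<comment> \<open>\<open>X n\<close> is a whole number of periods, and the extra \<open>pi\<close>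
    reverses the sign of the sine part.\<close>
  have J: "J (X n) = 1 / g + S" "J (X n + pi) = 1 / g - S" for n
  proof -
    have sin: "sin (X n + s) = sin s" "sin (X n + pi + s) = - sin s" for s
    proof -
      have "cos (X n) = 1" "sin (X n) = 0"
        using cos_2npi[of n] sin_2npi[of n] by (simp_all add: X_def mult_ac)
      then show "sin (X n + s) = sin s" "sin (X n + pi + s) = - sin s"
        by (simp_all add: sin_add cos_add)
    qed
    show "J (X n) = 1 / g + S" "J (X n + pi) = 1 / g - S"
      unfolding J_def sin using inte ints e1 by (simp_all add: distrib_left right_diff_distrib S_def)
  qed
  have lim: "((\<lambda>x. G x - c * J x) \<longlongrightarrow> 0) at_top"
    unfolding G_def J_def e_def
  proof (rule tail_tilt_asymptotics[OF p _ _ _ g])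
    show "\<bar>1 + sin x\<bar> \<le> 2" for x :: real
      using sin_le_one[of x] sin_ge_minus_one[of x] by linarith
  qed (use c in auto)
  have X: "filterlim X at_top sequentially" unfolding X_def by real_asymp
  have X': "filterlim (\<lambda>n. X n + pi) at_top sequentially"
    unfolding X_def by real_asymp
  have 1: "(\<lambda>n. G (X n)) \<longlonglongrightarrow> c * (1 / g + S)"
    using filterlim_compose[OF lim X] by (simp only: J LIM_zero_iff)
  have 2: "(\<lambda>n. G (X n + pi)) \<longlonglongrightarrow> c * (1 / g - S)"
    using filterlim_compose[OF lim X'] by (simp only: J LIM_zero_iff)
  \<comment> \<open>Shift by half a period: the normalisation in \<open>G\<close> cancels
    \<open>exp (- g * pi)\<close>, and the change in the quadratic weight is negligible.\<close>
  have T: "(\<lambda>x. tail (tilt g c p) (x + pi)) \<sim>[at_top] (\<lambda>x. exp (- g * pi) * tail (tilt g c p) x)"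
    using L by (auto simp: class_L_def)
  have "(\<lambda>x. (1 + (x + pi)\<^sup>2) * exp (g * (x + pi))) \<sim>[at_top] (\<lambda>x. (1 + x\<^sup>2) * exp (g * (x + pi)))"
    by (intro asymp_equiv_mult asymp_equiv_refl) real_asymp
  from asymp_equiv_mult[OF this T]
  moreover have "(1 + x\<^sup>2) * exp (g * (x + pi)) * (exp (- g * pi) * tail (tilt g c p) x) = G x" for x
  proof -
    have "exp (g * (x + pi)) * exp (- g * pi) = exp (g * x)"
      by (simp add: exp_add[symmetric] algebra_simps)
    then show ?thesis by (simp only: G_def mult.assoc[symmetric]) (simp only: mult.assoc)
  qed
  ultimately have "(\<lambda>x. G (x + pi)) \<sim>[at_top] G"
    by (simp only: G_def[of "_ + pi"])
  from asymp_equiv_compose[OF this X]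
  have "(\<lambda>n. G (X n + pi)) \<sim>[sequentially] (\<lambda>n. G (X n))" by (simp add: o_def)
  \<comment> \<open>Both subsequences now share one limit, which forces
    \<open>1 / g - S = 1 / g + S\<close>.\<close>
  from tendsto_asymp_equiv_cong[OF this] 2
  have "(\<lambda>n. G (X n)) \<longlonglongrightarrow> c * (1 / g - S)" by simp
  from LIMSEQ_unique[OF this 1] have "S = 0" using c by simp
  moreover have "S = 1 / (1 + g\<^sup>2)"
    using integral_exp_decay_sin[OF g] by (simp add: S_def e_def)
  ultimately show False using one_plus_square_pos[of g] by simp
qed

section \<open>An oscillating profile without Fourier component at frequency 1\<close>

text \<open>The bump on \<open>{0..2 * pi}\<close> is there to cancel the Fourier coefficients of the oscillating part at frequency 1.\<close>

lemma oscillating_profile_exists: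
  obtains p where "inv_square_profile p (\<lambda>x. 1 + sin x)" "\<And>x. x < 0 \<Longrightarrow> p x = 0"
    "0 < (\<integral>x. p x \<partial>lborel)"
    "(\<integral>x. p x * cos x \<partial>lborel) = 0" "(\<integral>x. p x * sin x \<partial>lborel) = 0"
proof -
  \<comment> \<open>Support on the half-line keeps the later factor \<open>exp (- g * x)\<close>
    bounded where the density lives.\<close>
  define q :: "real \<Rightarrow> real" where "q x = indicator {0..} x * ((1 + sin x) / (1 + x\<^sup>2))" for x
  \<comment> \<open>Over a full period \<open>cos\<close> and \<open>sin\<close> are orthogonal to
    each other and to constants, and their squares integrate to \<open>pi\<close>; hence the
    division by \<open>pi\<close>.\<close>
  define A where "A = - (\<integral>x. q x * cos x \<partial>lborel) / pi"
  define B where "B = - (\<integral>x. q x * sin x \<partial>lborel) / pi"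
  \<comment> \<open>This constant keeps the bump at least 1 on its interval, which secures both
    nonnegativity of \<open>p\<close> and a positive integral.\<close>
  define C where "C = 1 + \<bar>A\<bar> + \<bar>B\<bar>"
  define b where "b x = C + A * cos x + B * sin x" for x
  define p where "p x = q x + b x * indicator {0..2 * pi} x" for x
  have sin1: "0 \<le> 1 + sin x" "1 + sin x \<le> 2" for x :: real
    using sin_le_one[of x] sin_ge_minus_one[of x] by linarith+
  have b: "1 \<le> b x" "b x \<le> 2 * C" for x
  proof -
    have "\<bar>A * cos x\<bar> \<le> \<bar>A\<bar>" "\<bar>B * sin x\<bar> \<le> \<bar>B\<bar>"
      by (simp_all add: abs_mult mult_left_le)
    moreover have "1 \<le> 1 + a + b' + u + v \<and> 1 + a + b' + u + v \<le> 2 * (1 + a + b')"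
      if "\<bar>u\<bar> \<le> a" "\<bar>v\<bar> \<le> b'" for a b' u v :: real
      using that by (auto simp: abs_le_iff)
    ultimately show "1 \<le> b x" "b x \<le> 2 * C" unfolding b_def C_def by blast+
  qed
  have q: "0 \<le> q x" "(1 + x\<^sup>2) * q x \<le> 2" for x
    using sin1[of x] one_plus_square_pos[of x] by (auto simp: q_def indicator_def)
  have p_nn: "0 \<le> p x" for x
    using q b[of x] by (auto simp: p_def indicator_def)
  have [measurable]: "q \<in> borel_measurable borel" "b \<in> borel_measurable borel" "p \<in> borel_measurable borel"
    unfolding p_def[abs_def] q_def[abs_def] b_def[abs_def] by measurable
  have bound: "(1 + x\<^sup>2) * p x \<le> 2 + (1 + (2 * pi)\<^sup>2) * (2 * C)" for x
  proof -
    have "(1 + x\<^sup>2) * (b x * indicator {0..2 * pi} x) \<le> (1 + (2 * pi)\<^sup>2) * (2 * C)"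
    proof (cases "x \<in> {0..2 * pi}")
      case True
      then have "x\<^sup>2 \<le> (2 * pi)\<^sup>2" by (intro power_mono) auto
      then have "(1 + x\<^sup>2) * b x \<le> (1 + (2 * pi)\<^sup>2) * (2 * C)"
        using b[of x] by (intro mult_mono) auto
      then show ?thesis using True by simp
    qed (simp add: C_def)
    then show ?thesis using q(2)[of x] by (simp add: p_def distrib_left)
  qed
  \<comment> \<open>The bump has bounded support, so it does not affect the profile at
    infinity.\<close>
  have "\<forall>\<^sub>F x in at_top. (1 + x\<^sup>2) * p x - (1 + sin x) = 0"
    using eventually_gt_at_top[of "2 * pi"]
  proof eventually_elim
    case (elim x)
    then have "0 \<le> x" using pi_gt_zero by linarith
    then show ?case using elim one_plus_square_pos[of x] by (simp add: p_def q_def)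
  qed
  then have "((\<lambda>x. (1 + x\<^sup>2) * p x - (1 + sin x)) \<longlongrightarrow> 0) at_top"
    by (rule tendsto_eventually)
  then have prof: "inv_square_profile p (\<lambda>x. 1 + sin x)"
    using p_nn bound by (auto simp: inv_square_profile_def)
  have intp: "integrable lborel p" by (rule inv_square_profile_integrable[OF prof])
  have FTC: "has_bochner_integral lborel (\<lambda>x. 1 * indicator {0..2 * pi} x) (2 * pi)"
    "has_bochner_integral lborel (\<lambda>x. b x * cos x * indicator {0..2 * pi} x) (A * pi)"
    "has_bochner_integral lborel (\<lambda>x. b x * sin x * indicator {0..2 * pi} x) (B * pi)"
  proof -
    have cos2: "(cos x)\<^sup>2 = 1 - (sin x)\<^sup>2" for x :: real
      by (simp add: cos_squared_eq)
    show "has_bochner_integral lborel (\<lambda>x. 1 * indicator {0..2 * pi} x) (2 * pi)"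
      using has_bochner_integral_FTC_Icc_real[of 0 "2 * pi" "\<lambda>x. x" "\<lambda>_. 1"] by auto
    \<comment> \<open>Of this antiderivative only the term \<open>A * x / 2\<close> differs between
      the endpoints; in the sine case below it is \<open>B * x / 2\<close>.\<close>
    have "has_bochner_integral lborel (\<lambda>x. b x * cos x * indicator {0..2 * pi} x)
      ((\<lambda>x. C * sin x + A * (x + sin x * cos x) / 2 + B * (sin x)\<^sup>2 / 2) (2 * pi) -
       (\<lambda>x. C * sin x + A * (x + sin x * cos x) / 2 + B * (sin x)\<^sup>2 / 2) 0)"
      by (rule has_bochner_integral_FTC_Icc_real)
         (auto simp: b_def power2_eq_square[symmetric] cos2 algebra_simps diff_divide_distrib
           intro!: derivative_eq_intros continuous_intros)
    then show "has_bochner_integral lborel (\<lambda>x. b x * cos x * indicator {0..2 * pi} x) (A * pi)"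
      by simp
    have "has_bochner_integral lborel (\<lambda>x. b x * sin x * indicator {0..2 * pi} x)
      ((\<lambda>x. - C * cos x + A * (sin x)\<^sup>2 / 2 + B * (x - sin x * cos x) / 2) (2 * pi) -
       (\<lambda>x. - C * cos x + A * (sin x)\<^sup>2 / 2 + B * (x - sin x * cos x) / 2) 0)"
      by (rule has_bochner_integral_FTC_Icc_real)
         (auto simp: b_def power2_eq_square[symmetric] cos2 algebra_simps diff_divide_distrib
           intro!: derivative_eq_intros continuous_intros)
    then show "has_bochner_integral lborel (\<lambda>x. b x * sin x * indicator {0..2 * pi} x) (B * pi)"
      by simp
  qed
  have "2 * pi \<le> (\<integral>x. p x \<partial>lborel)"
  proof -
    have "(\<integral>x. 1 * indicator {0..2 * pi} x \<partial>lborel) \<le> (\<integral>x. p x \<partial>lborel)"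
    proof (intro integral_mono)
      show "1 * indicator {0..2 * pi} x \<le> p x" for x
        using q(1)[of x] b(1)[of x] by (auto simp: p_def indicator_def)
    qed (use FTC(1) intp in \<open>auto simp: has_bochner_integral_iff\<close>)
    then show ?thesis using FTC(1) by (simp add: has_bochner_integral_iff)
  qed
  then have pos: "0 < (\<integral>x. p x \<partial>lborel)" using pi_gt_zero by linarith
  \<comment> \<open>The bump is nonnegative, so \<open>0 \<le> q x \<le> p x\<close> and
    integrability passes from \<open>p\<close> to \<open>q\<close>.\<close>
  have intq: "integrable lborel q"
    by (rule Bochner_Integration.integrable_bound[OF intp]) (use q order_trans[OF zero_le_one b(1)] in \<open>auto simp: p_def indicator_def intro!: AE_I2\<close>)
  have iq: "integrable lborel (\<lambda>x. q x * cos x)" "integrable lborel (\<lambda>x. q x * sin x)"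
    by (rule integrable_mult_bounded[OF intq, where B = 1]; simp)+
  have pc: "(\<integral>x. p x * cos x \<partial>lborel) =
      (\<integral>x. q x * cos x + b x * cos x * indicator {0..2 * pi} x \<partial>lborel)"
    by (intro Bochner_Integration.integral_cong) (auto simp: p_def algebra_simps)
  have ps: "(\<integral>x. p x * sin x \<partial>lborel) =
      (\<integral>x. q x * sin x + b x * sin x * indicator {0..2 * pi} x \<partial>lborel)"
    by (intro Bochner_Integration.integral_cong) (auto simp: p_def algebra_simps)
  have "(\<integral>x. p x * cos x \<partial>lborel) = 0"
    unfolding pc using iq FTC(2) by (simp add: has_bochner_integral_iff A_def)
  moreover have "(\<integral>x. p x * sin x \<partial>lborel) = 0"
    unfolding ps using iq FTC(3) by (simp add: has_bochner_integral_iff B_def)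
  moreover have "p x = 0" if "x < 0" for x using that by (simp add: p_def q_def)
  ultimately show ?thesis using that prof pos by blast
qed

section \<open>A convolution square in \<open>class_S\<close> whose root is not\<close>

theorem theorem1p1:
  fixes g :: real
  assumes "g > 0"
  shows "\<exists>\<mu> :: real measure. \<exists>n :: nat. n \<ge> 1 \<and> real_distribution \<mu> \<and>
           class_S g (conv_pow \<mu> n) \<and> \<not> class_S g \<mu>"
proof -
  obtain p where p: "inv_square_profile p (\<lambda>x. 1 + sin x)" and p0: "\<And>x. x < 0 \<Longrightarrow> p x = 0"
    and P: "0 < (\<integral>x. p x \<partial>lborel)"
    and osc: "(\<integral>x. p x * cos x \<partial>lborel) = 0" "(\<integral>x. p x * sin x \<partial>lborel) = 0"
    using oscillating_profile_exists by metis
  note [measurable] = inv_square_profile_measurable[OF p]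
  note nn = inv_square_profile_nonneg[OF p]
  note int = inv_square_profile_integrable[OF p]
  define Z where "Z = (\<integral>x. exp (- g * x) * p x \<partial>lborel)"
  \<comment> \<open>\<open>p\<close> vanishes on the negative half-line, and elsewhere the
    exponential is at most 1.\<close>
  have inte: "integrable lborel (\<lambda>x. exp (- g * x) * p x)"
  proof -
    have "integrable lborel (\<lambda>x. p x * (indicator {0..} x * exp (- g * x)))"
      using assms by (intro integrable_mult_bounded[OF int, where B = 1]) (auto simp: indicator_def)
    also have "(\<lambda>x. p x * (indicator {0..} x * exp (- g * x))) = (\<lambda>x. exp (- g * x) * p x)"
      using p0 by (auto simp: indicator_def fun_eq_iff not_le)
    finally show ?thesis .
  qed
  have Z: "0 < Z"
  proof -
    have "Z \<noteq> 0"
    proof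
      assume "Z = 0"
      then have "AE x in lborel. exp (- g * x) * p x = 0"
        unfolding Z_def using inte nn by (subst (asm) integral_nonneg_eq_0_iff_AE) auto
      then have "AE x in lborel. p x = 0" by simp
      then have "(\<integral>x. p x \<partial>lborel) = 0" by (rule integral_eq_zero_AE)
      with P show False by simp
    qed
    moreover have "0 \<le> Z" unfolding Z_def using nn by simp
    ultimately show ?thesis by simp
  qed
  define c where "c = 1 / Z"
  have c: "0 < c" using Z by (simp add: c_def)
  define \<mu> where "\<mu> = tilt g c p"
  have "emeasure \<mu> (space \<mu>) = (\<integral>\<^sup>+x. ennreal (c * (exp (- g * x) * p x)) \<partial>lborel)"
    unfolding \<mu>_def tilt_def by (simp add: emeasure_density mult.assoc)
  also have "\<dots> = ennreal (\<integral>x. c * (exp (- g * x) * p x) \<partial>lborel)"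
    using inte c nn by (intro nn_integral_eq_integral) auto
  also have "\<dots> = ennreal (c * Z)" by (simp only: Z_def integral_mult_right_zero)
  also have "\<dots> = 1" using Z by (simp add: c_def)
  finally interpret prob_space \<mu> by (rule prob_spaceI)
  have fin: "finite_measure (tilt g c p)" using finite_measure_axioms by (simp add: \<mu>_def)
  have dist: "real_distribution \<mu>"
    using prob_space_axioms by (simp add: real_distribution_def \<mu>_def)
  define P where "P = (\<integral>x. p x \<partial>lborel)"
  \<comment> \<open>By the addition formula, \<open>sin (x - y)\<close> contributes only the cosine
    and sine coefficients of \<open>p\<close>, which are both 0; this removes the dependence on
    \<open>x\<close>.\<close>
  have conv: "(\<integral>y. p y * (1 + sin (x - y)) \<partial>lborel) = P" for x
  proof -
    have "integrable lborel (\<lambda>y. p y * cos y)" "integrable lborel (\<lambda>y. p y * sin y)"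
      by (rule integrable_mult_bounded[OF int, where B = 1]; simp)+
    moreover have "(\<integral>y. p y * (1 + sin (x - y)) \<partial>lborel) =
        (\<integral>y. p y + sin x * (p y * cos y) - cos x * (p y * sin y) \<partial>lborel)"
      by (intro Bochner_Integration.integral_cong) (auto simp: sin_diff algebra_simps)
    ultimately show ?thesis using int osc by (simp add: P_def)
  qed
  have "inv_square_profile (self_conv p) (\<lambda>x. 2 * (\<integral>y. p y * (1 + sin (x - y)) \<partial>lborel))"
  proof (rule inv_square_profile_self_conv[OF p])
    show "\<bar>1 + sin x\<bar> \<le> 2" for x :: real
      using sin_le_one[of x] sin_ge_minus_one[of x] by linarith
  qed simp
  then have prof2: "inv_square_profile (self_conv p) (\<lambda>_. 2 * P)" by (simp add: conv)
  have conv2: "conv_pow \<mu> 2 = tilt g (c\<^sup>2) (self_conv p)"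
    using tilt_convolution[OF p _ fin] conv_pow_2[OF fin] c by (simp add: \<mu>_def)
  have fin2: "finite_measure (tilt g (c\<^sup>2) (self_conv p))"
    using convolution_finite[OF fin fin] tilt_convolution[OF p _ fin] c by simp
  \<comment> \<open>The exponential moment is multiplicative under convolution; comparing its two
    evaluations shows that \<open>self_conv p\<close> integrates to
    \<open>P\<^sup>2\<close>.\<close>
  have P2: "0 < (\<integral>x. self_conv p x \<partial>lborel)"
  proof -
    have "ennreal (c\<^sup>2 * (\<integral>x. self_conv p x \<partial>lborel)) = mgf (convolution (tilt g c p) (tilt g c p)) g"
      using mgf_tilt[OF prof2, of "c\<^sup>2" g] tilt_convolution[OF p _ fin] c by simp
    also have "\<dots> = (\<integral>\<^sup>+x. \<integral>\<^sup>+y. ennreal (exp (g * x)) * ennreal (exp (g * y)) \<partial>tilt g c p \<partial>tilt g c p)"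
      unfolding mgf_def
      by (subst nn_integral_convolution)
         (auto simp: fin ennreal_mult'[symmetric] exp_add[symmetric] distrib_left)
    also have "\<dots> = mgf (tilt g c p) g * mgf (tilt g c p) g"
      unfolding mgf_def by (simp add: nn_integral_cmult nn_integral_multc measurable_cong_sets[OF sets_tilt refl])
    also have "\<dots> = ennreal ((c * P)\<^sup>2)"
      using mgf_tilt[OF p] c P by (simp add: P_def ennreal_mult[symmetric] power2_eq_square)
    finally have "c\<^sup>2 * (\<integral>x. self_conv p x \<partial>lborel) = (c * P)\<^sup>2"
      using inv_square_profile_nonneg[OF prof2] by (subst (asm) ennreal_inj) auto
    then show ?thesis using c P by (simp add: P_def power_mult_distrib)
  qed
  \<comment> \<open>The square has the constant profile \<open>2 * P\<close>, while its root already
    fails \<open>class_L\<close>; so \<open>n = 2\<close> works.\<close>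
  have "class_S g (conv_pow \<mu> 2)"
    unfolding conv2 using class_S_tilt[OF prof2 _ assms _ P2 fin2] c P by (simp add: P_def)
  moreover have "\<not> class_S g \<mu>"
    using not_class_L_tilt_sin[OF p c assms] by (simp add: class_S_def \<mu>_def)
  ultimately show ?thesis using dist by (intro exI[of _ \<mu>] exI[of _ 2]) simp
qed

end
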